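(* Let $\ell,s,w$ be arbitrary positive integers and let $n=\ell s w+1$. Then every ordered matching on $2n$ vertices contains a line of size $\ell+1$, or a stack of size $s+1$, or a wave of size $w+1$.
   Context: An ordered matching of size $n$ is a graph on a linearly ordered vertex set $V$ with $|V|=2n$ (say $V=\{1,\dots,2n\}$) consisting of $n$ pairwise vertex-disjoint edges (so there are no isolated vertices). The size of a matching is its number of edges. A sub-matching is a subset of the edges, its vertices inheriting the linear order. A matching with $k$ edges $\{a_i,b_i\}$, $a_i<b_i$, $i=1,\dots,k$, numbered so that $a_1<\cdots<a_k$, is called: a line if $a_1<b_1<a_2<b_2<\cdots<a_k<b_k$; a stack if $a_1<a_2<\cdots<a_k<b_k<b_{k-1}<\cdots<b_1$; a wave if $a_1<a_2<\cdots<a_k<b_1<b_2<\cdots<b_k$. A matching contains a line (stack, wave) if some sub-matching of it is a line (stack, wave). *)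

theory Defs
  imports Main
begin

text \<open>
  A (sub-)matching is given by its set of edges, an edge being a two-element set of vertices.
  The vertices carry the linear order of their type.
\<close>

definition ordered_matching :: "nat \<Rightarrow> 'a::linorder set \<Rightarrow> 'a set set \<Rightarrow> bool" where
  "ordered_matching n V M \<longleftrightarrow>
     finite V \<and> card V = 2 * n \<and>
     (\<forall>e\<in>M. e \<subseteq> V \<and> card e = 2) \<and> pairwise disjnt M \<and> card M = n"

text \<open>
  In the three definitions below the chain of inequalities between the left endpoints
  \<open>a 0, \<dots>, a (k - 1)\<close> and the right endpoints \<open>b 0, \<dots>, b (k - 1)\<close> is expressed by listing
  all endpoints in the order in which they occur in the chain. The chain makes all
  endpoints distinct, so \<open>k\<close> is the cardinality of \<open>M\<close>.
\<close>

definition is_line :: "'a::linorder set set \<Rightarrow> bool" where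
  "is_line M \<longleftrightarrow> (\<exists>k a b. M = (\<lambda>i. {a i, b i}) ` {..<k} \<and>
     sorted_wrt (<) (concat (map (\<lambda>i. [a i, b i]) [0..<k])))"

definition is_stack :: "'a::linorder set set \<Rightarrow> bool" where
  "is_stack M \<longleftrightarrow> (\<exists>k a b. M = (\<lambda>i. {a i, b i}) ` {..<k} \<and>
     sorted_wrt (<) (map a [0..<k] @ rev (map b [0..<k])))"

definition is_wave :: "'a::linorder set set \<Rightarrow> bool" where
  "is_wave M \<longleftrightarrow> (\<exists>k a b. M = (\<lambda>i. {a i, b i}) ` {..<k} \<and>
     sorted_wrt (<) (map a [0..<k] @ map b [0..<k]))"

definition contains_line :: "'a::linorder set set \<Rightarrow> nat \<Rightarrow> bool" where
  "contains_line M k \<longleftrightarrow> (\<exists>L\<subseteq>M. card L = k \<and> is_line L)"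

definition contains_stack :: "'a::linorder set set \<Rightarrow> nat \<Rightarrow> bool" where
  "contains_stack M k \<longleftrightarrow> (\<exists>S\<subseteq>M. card S = k \<and> is_stack S)"

definition contains_wave :: "'a::linorder set set \<Rightarrow> nat \<Rightarrow> bool" where
  "contains_wave M k \<longleftrightarrow> (\<exists>W\<subseteq>M. card W = k \<and> is_wave W)"

end

theory Submission
  imports Defs
begin

text \<open>
  Two disjoint edges form a line, a stack or a wave. Being to the left of an edge and being nested
  inside an edge are transitive relations, so by Mirsky's theorem, if all lines have size at most
  \<open>l\<close> and all stacks size at most \<open>s\<close>, some \<open>w + 1\<close> edges are pairwise crossing;
  ordered by left endpoints they form a wave.
\<close>

text \<open>Mirsky's argument: without a chain of \<open>k + 1\<close> entries, the number
  \<open>h x\<close> of entries of a longest chain that can precede \<open>x\<close> takes at most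
  \<open>k\<close> values, so some level set of \<open>h\<close> has more than \<open>m\<close>
  elements. As \<open>R x y\<close> forces \<open>h x < h y\<close>, no two elements of a level are
  related; this includes \<open>x = y\<close>, since repeating an \<open>x\<close> with
  \<open>R x x\<close> would give arbitrarily long chains.\<close>

lemma chain_or_antichain:
  fixes R :: "'b \<Rightarrow> 'b \<Rightarrow> bool"
  assumes fin: "finite A" and trans: "transp_on A R" and card: "card A > k * m"
  obtains (chain) xs where "set xs \<subseteq> A" "sorted_wrt R xs" "length xs = k + 1"
  | (antichain) B where "B \<subseteq> A" "card B > m" "\<And>x y. x \<in> B \<Longrightarrow> y \<in> B \<Longrightarrow> \<not> R x y"
proof (cases "\<exists>xs. set xs \<subseteq> A \<and> sorted_wrt R xs \<and> length xs = k + 1")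
  case True
  then show ?thesis using chain by blast
next
  case False
  \<comment> \<open>The lengths leave out \<open>x\<close> itself, so the values lie in
    \<open>{..<k}\<close>, including 0 from the empty list.\<close>
  define P where "P x = {length xs | xs. set xs \<subseteq> A \<and> sorted_wrt R (xs @ [x])}" for x
  define h where "h x = Max (P x)" for x
  have P_sub: "P x \<subseteq> {..<k}" if "x \<in> A" for x
  proof
    fix j assume "j \<in> P x"
    then obtain xs where xs: "j = length xs" "set xs \<subseteq> A" "sorted_wrt R (xs @ [x])"
      by (auto simp: P_def)
    show "j \<in> {..<k}"
    proof (rule ccontr)
      assume "j \<notin> {..<k}"
      \<comment> \<open>With at least \<open>k\<close> entries before \<open>x\<close>, the chain
        ending in \<open>x\<close> has a prefix of exactly the excluded length
        \<open>k + 1\<close>.\<close>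
      then have "length (take (k + 1) (xs @ [x])) = k + 1"
        using xs(1) by auto
      moreover have "set (take (k + 1) (xs @ [x])) \<subseteq> A"
        using set_take_subset[of "k + 1" "xs @ [x]"] xs(2) that by auto
      ultimately show False
        using False sorted_wrt_take[OF xs(3)] by blast
    qed
  qed
  then have fin_P: "finite (P x)" if "x \<in> A" for x
    using that finite_subset by blast
  have h_in: "h x \<in> P x" if "x \<in> A" for x
  proof -
    have "0 \<in> P x" by (auto simp: P_def)
    then show ?thesis unfolding h_def using fin_P[OF that] by (intro Max_in) auto
  qed
  have h_less: "h x < h y" if "x \<in> A" "y \<in> A" "R x y" for x y
  proof -
    obtain xs where xs: "h x = length xs" "set xs \<subseteq> A" "sorted_wrt R (xs @ [x])"
      using h_in[OF \<open>x \<in> A\<close>] by (auto simp: P_def)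
    \<comment> \<open>Appending \<open>y\<close> to a longest chain ending in \<open>x\<close> keeps
      it a chain, by transitivity through \<open>x\<close>.\<close>
    have "R z y" if "z \<in> set xs" for z
      using that xs \<open>x \<in> A\<close> \<open>y \<in> A\<close> \<open>R x y\<close> transp_onD[OF trans, of z x y]
      by (auto simp: sorted_wrt_append)
    then have "sorted_wrt R ((xs @ [x]) @ [y])"
      using xs(3) \<open>R x y\<close> by (auto simp: sorted_wrt_append)
    moreover have "set (xs @ [x]) \<subseteq> A" using xs(2) \<open>x \<in> A\<close> by simp
    ultimately have "length (xs @ [x]) \<in> P y"
      unfolding P_def by blast
    then have "length (xs @ [x]) \<le> h y"
      unfolding h_def using fin_P[OF \<open>y \<in> A\<close>] by simp
    then show ?thesis using xs(1) by simp
  qed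
  have "\<exists>j<k. card {x \<in> A. h x = j} > m"
  proof (rule ccontr)
    assume "\<not> ?thesis"
    then have small: "card {x \<in> A. h x = j} \<le> m" if "j < k" for j
      using that by (meson not_le)
    have "A = (\<Union>j<k. {x \<in> A. h x = j})"
      using h_in P_sub by auto
    then have "card A \<le> (\<Sum>j<k. card {x \<in> A. h x = j})"
      using card_UN_le[of "{..<k}" "\<lambda>j. {x \<in> A. h x = j}"] by simp
    also have "\<dots> \<le> k * m"
      using sum_bounded_above[of "{..<k}" "\<lambda>j. card {x \<in> A. h x = j}" m] small by simp
    finally show False using card by simp
  qed
  then obtain j where j: "card {x \<in> A. h x = j} > m" by blast
  show ?thesis
    by (rule antichain[OF _ j]) (auto dest: h_less)
qed

lemma map_nth_comp: "map (\<lambda>i. f (xs ! i)) [0..<length xs] = map f xs"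
  by (rule nth_equalityI) simp_all

lemma set_eq_nth_image: "set xs = (\<lambda>i. xs ! i) ` {..<length xs}"
  by (auto simp: set_conv_nth)

lemma sorted_wrt_cases:
  assumes "sorted_wrt R xs" and "x \<in> set xs" and "y \<in> set xs"
  shows "x = y \<or> R x y \<or> R y x"
  using assms by (induction xs) auto

context
  fixes M :: "'a::linorder set set"
  assumes card_edge: "\<forall>e\<in>M. card e = 2"
begin

lemma edge_Min_Max:
  assumes "e \<in> M"
  shows "e = {Min e, Max e}" and "Min e < Max e"
proof -
  obtain x y where "e = {x, y}" "x \<noteq> y"
    using card_edge assms by (auto simp: card_2_iff)
  then show "e = {Min e, Max e}" "Min e < Max e"
    by (auto simp: min_def max_def)
qed

text \<open>Supplies the endpoint functions that serve as witnesses \<open>a\<close> and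
  \<open>b\<close> for lines, stacks and waves.\<close>

lemma edges_eq_image:
  assumes "set xs \<subseteq> M"
  shows "set xs = (\<lambda>i. {Min (xs ! i), Max (xs ! i)}) ` {..<length xs}"
proof -
  have "{Min (xs ! i), Max (xs ! i)} = xs ! i" if "i < length xs" for i
    using edge_Min_Max(1)[of "xs ! i"] nth_mem[OF that] assms by auto
  then show ?thesis unfolding set_eq_nth_image by simp
qed

text \<open>Strictly increasing left endpoints rule out repetitions, so list length can replace the
  cardinality used in the containment predicates.\<close>

lemma card_chain:
  assumes "set xs \<subseteq> M" and "sorted_wrt (\<lambda>e f. Min e < Min f) xs"
  shows "card (set xs) = length xs"
proof -
  have "sorted_wrt (<) (map Min xs)" using assms(2) by (simp add: sorted_wrt_map)
  then have "distinct xs" using distinct_map strict_sorted_iff by blast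
  then show ?thesis by (rule distinct_card)
qed

lemma contains_line_chain:
  assumes xs: "set xs \<subseteq> M" and chain: "sorted_wrt (\<lambda>e f. Max e < Min f) xs"
  shows "contains_line M (length xs)"
proof -
  have "sorted_wrt (<) (concat (map (\<lambda>e. [Min e, Max e]) xs))"
    using assms
  proof (induction xs)
    case (Cons e xs)
    \<comment> \<open>Both endpoints of every later edge must exceed those of the head
      \<open>e\<close>.\<close>
    have "Max e < Min f \<and> Max e < Max f" if "f \<in> set xs" for f
      using Cons.prems that edge_Min_Max(2)[of f] by fastforce
    moreover have "Min e < Max e" using Cons.prems(1) edge_Min_Max(2)[of e] by simp
    ultimately show ?case using Cons by fastforce
  qed simp
  then have "is_line (set xs)"
    unfolding is_line_def
    using edges_eq_image[OF xs] map_nth_comp[of "\<lambda>e. [Min e, Max e]" xs]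
    by (intro exI[of _ "length xs"] exI[of _ "\<lambda>i. Min (xs ! i)"] exI[of _ "\<lambda>i. Max (xs ! i)"]) simp
  moreover have "sorted_wrt (\<lambda>e f. Min e < Min f) xs"
    using chain xs edge_Min_Max(2)
    by (intro sorted_wrt_mono_rel[OF _ chain]) (meson less_trans subsetD)
  ultimately show ?thesis
    unfolding contains_line_def using card_chain[OF xs] xs by blast
qed

lemma contains_stack_chain:
  assumes xs: "set xs \<subseteq> M" and chain: "sorted_wrt (\<lambda>e f. Min e < Min f \<and> Max f < Max e) xs"
  shows "contains_stack M (length xs)"
proof -
  have mins: "sorted_wrt (\<lambda>e f. Min e < Min f) xs"
    and maxs: "sorted_wrt (\<lambda>e f. Max f < Max e) xs"
    using chain by (auto elim!: sorted_wrt_mono_rel[rotated])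
  \<comment> \<open>This joins the two halves of the list: if \<open>e\<close> is the outer edge,
    pass through \<open>Min f\<close>; if it is the inner one, pass through
    \<open>Max e\<close>.\<close>
  have "Min e < Max f" if "e \<in> set xs" "f \<in> set xs" for e f
    using sorted_wrt_cases[OF chain that] edge_Min_Max(2)[of e] edge_Min_Max(2)[of f] that xs
    by (auto intro: less_trans)
  with mins maxs have "sorted_wrt (<) (map Min xs @ rev (map Max xs))"
    by (auto simp: sorted_wrt_append sorted_wrt_map sorted_wrt_rev)
  then have "is_stack (set xs)"
    unfolding is_stack_def
    using edges_eq_image[OF xs] map_nth_comp[of Min xs] map_nth_comp[of Max xs]
    by (intro exI[of _ "length xs"] exI[of _ "\<lambda>i. Min (xs ! i)"] exI[of _ "\<lambda>i. Max (xs ! i)"]) simp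
  then show ?thesis
    unfolding contains_stack_def using card_chain[OF xs mins] xs by blast
qed

lemma contains_wave_chain:
  assumes xs: "set xs \<subseteq> M" and mins: "sorted_wrt (\<lambda>e f. Min e < Min f) xs"
    and crossing: "\<And>e f. e \<in> set xs \<Longrightarrow> f \<in> set xs \<Longrightarrow> Min e < Min f \<Longrightarrow> Min f < Max e \<and> Max e < Max f"
  shows "contains_wave M (length xs)"
proof -
  have maxs: "sorted_wrt (\<lambda>e f. Max e < Max f) xs"
    using crossing by (intro sorted_wrt_mono_rel[OF _ mins]) blast
  \<comment> \<open>If \<open>e\<close> comes first, then \<open>Min e < Max e < Max f\<close>; if
    \<open>f\<close> comes first, this is the first half of \<open>crossing\<close> with the roles
    exchanged.\<close>
  have "Min e < Max f" if "e \<in> set xs" "f \<in> set xs" for e f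
    using sorted_wrt_cases[OF mins that] crossing that edge_Min_Max(2)[of e] xs
    by (metis less_trans subsetD)
  with mins maxs have "sorted_wrt (<) (map Min xs @ map Max xs)"
    by (auto simp: sorted_wrt_append sorted_wrt_map)
  then have "is_wave (set xs)"
    unfolding is_wave_def
    using edges_eq_image[OF xs] map_nth_comp[of Min xs] map_nth_comp[of Max xs]
    by (intro exI[of _ "length xs"] exI[of _ "\<lambda>i. Min (xs ! i)"] exI[of _ "\<lambda>i. Max (xs ! i)"]) simp
  then show ?thesis
    unfolding contains_wave_def using card_chain[OF xs mins] xs by blast
qed

lemma disjoint_edges_endpoints:
  assumes "pairwise disjnt M" and "e \<in> M" and "f \<in> M" and "e \<noteq> f"
  shows "Min e \<noteq> Min f" and "Max e \<noteq> Min f" and "Max e \<noteq> Max f"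
proof -
  have "disjnt {Min e, Max e} {Min f, Max f}"
    using pairwiseD[OF assms(1-4)] edge_Min_Max(1)[OF assms(2)] edge_Min_Max(1)[OF assms(3)] by simp
  then show "Min e \<noteq> Min f" "Max e \<noteq> Min f" "Max e \<noteq> Max f"
    by auto
qed

end

theorem theorem1:
  fixes l s w n :: nat and V :: "'a::linorder set" and M :: "'a set set"
  assumes "l > 0" and "s > 0" and "w > 0"
    and "n = l * s * w + 1"
    and "ordered_matching n V M"
  shows "contains_line M (l + 1) \<or> contains_stack M (s + 1) \<or> contains_wave M (w + 1)"
proof -
  have edge: "\<forall>e\<in>M. card e = 2" and disj: "pairwise disjnt M" and card: "card M = n"
    using assms(5) by (auto simp: ordered_matching_def)
  have fin: "finite M" using card assms(4) card.infinite by fastforce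
  have trans_line: "transp_on M (\<lambda>e f. Max e < Min f)"
    by (rule transp_onI) (meson edge_Min_Max(2)[OF edge] less_trans)
  \<comment> \<open>Grouped for two successive splits: first \<open>k = l\<close> and
    \<open>m = s * w\<close>, then \<open>k = s\<close> and \<open>m = w\<close>.\<close>
  have card_M: "card M > l * (s * w)" using card assms(4) by (simp add: mult.assoc)
  show ?thesis
  proof (cases rule: chain_or_antichain[OF fin trans_line card_M, case_names chain antichain])
    case (chain xs)
    then show ?thesis using contains_line_chain[OF edge, of xs] by simp
  next
    case (antichain B)
    have finB: "finite B" using antichain(1) fin finite_subset by blast
    have trans_stack: "transp_on B (\<lambda>e f. Min e < Min f \<and> Max f < Max e)"
      by (rule transp_onI) auto
    show ?thesis
    proof (cases rule: chain_or_antichain[OF finB trans_stack antichain(2), case_names chain antichain])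
      case (chain xs)
      then show ?thesis using contains_stack_chain[OF edge, of xs] antichain(1) by simp
    next
      case anti: (antichain C)
      have CM: "C \<subseteq> M" using anti(1) antichain(1) by simp
      \<comment> \<open>The two antichain properties exclude \<open>Max e < Min f\<close> and
        \<open>Max f < Max e\<close>; disjointness excludes the equalities, which makes both
        inequalities strict.\<close>
      have crossing: "Min f < Max e \<and> Max e < Max f"
        if "e \<in> C" "f \<in> C" "Min e < Min f" for e f
      proof -
        have "e \<in> M" "f \<in> M" "e \<in> B" "f \<in> B" "e \<noteq> f" using that CM anti(1) by auto
        moreover from this have "Max e \<noteq> Min f" "Max e \<noteq> Max f"
          using disjoint_edges_endpoints[OF edge disj] by blast+
        ultimately show ?thesis
          using antichain(3)[of e f] anti(3)[of e f] that by auto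
      qed
      have finC: "finite C" using anti(1) finB finite_subset by blast
      have trans_Min: "transp_on C (\<lambda>e f. Min e < Min f)"
        by (rule transp_onI) auto
      \<comment> \<open>The third split, with \<open>m = 1\<close>, only serves to list
        \<open>w + 1\<close> edges of \<open>C\<close> by left endpoint. Its antichain case would
        give two distinct edges with the same left endpoint, against disjointness.\<close>
      have card_C: "card C > w * 1" using anti(2) by simp
      show ?thesis
      proof (cases rule: chain_or_antichain[OF finC trans_Min card_C, case_names chain antichain])
        case (chain xs)
        have "contains_wave M (length xs)"
        proof (rule contains_wave_chain[OF edge _ chain(2)])
          show "set xs \<subseteq> M" using chain(1) CM by simp
        next
          fix e f assume "e \<in> set xs" "f \<in> set xs" "Min e < Min f"
          then show "Min f < Max e \<and> Max e < Max f"
            using chain(1) by (intro crossing) auto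
        qed
        then show ?thesis using chain(3) by simp
      next
        case single: (antichain D)
        have "\<exists>e f. e \<in> D \<and> f \<in> D \<and> e \<noteq> f"
          using single(2) card_le_Suc0_iff_eq[of D] card.infinite
          by (metis One_nat_def not_less not_less_zero)
        then obtain e f where ef: "e \<in> D" "f \<in> D" "e \<noteq> f" by blast
        then have "Min e \<noteq> Min f"
          using disjoint_edges_endpoints(1)[OF edge disj] single(1) CM by blast
        then show ?thesis using single(3) ef by (meson linorder_neqE)
      qed
    qed
  qed
qed

end
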